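(* Let $n\ge2$, let $0\le\alpha_1<\dots<\alpha_n$ be integers, and let $E=(x_1,\dots,x_n)$ be positive integers, with $p_i=\sum_{j\le i}x_j$, $q_i=\sum_{j\le i}\alpha_jx_j$ ($p_0=q_0=0$). Then $E$ is a correct score sequence for $D=\{\alpha_1,\dots,\alpha_n\}$ (i.e. the non-decreasing sequence consisting of $\alpha_i$ repeated $x_i$ times for $i=1,\dots,n$ is the score sequence of some tournament) if and only if $E$ appears in the net built by the net-building algorithm (described in the context) on input $D$, i.e. for every $i\in\{1,\dots,n\}$ the triple $(p_{i-1},q_{i-1},x_i)$ belongs to the cell $L_i(p_i,q_i)$.
   Context: A tournament is an orientation of a complete graph; its score sequence is its sequence of out-degrees. Net-building algorithm: set $\alpha_0=0$. For $k=0,\dots,n$ there is a table $L_k$ with cells indexed by integer pairs $(p,q)$, $0\le p\le 2\alpha_k+1$, $0\le q\le(2\alpha_k+1)\alpha_k$; each cell is a set of triples $(p',q',x)$, initially empty except $L_0(0,0)=\{(0,0,0)\}$. Let $B(p',q',a)=\frac{h+\sqrt{h^2+8(q'-p'(p'-1)/2)}}{2}$ with $h=2(a-p')+1$. First part: for $\ell=1,\dots,n-1$, for each integer $x$ with $1\le x\le 2\alpha_\ell+1$, for each $(p',q')$ with $0\le p'\le 2\alpha_{\ell-1}+1$, $0\le q'\le(2\alpha_{\ell-1}+1)\alpha_{\ell-1}$ and $L_{\ell-1}(p',q')\ne\emptyset$: if $x\le B(p',q',\alpha_\ell)$, insert $(p',q',x)$ into $L_\ell(p'+x,q'+x\alpha_\ell)$.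 Second part: for each $(p',q')$ in the same index range for $L_{n-1}$ with $L_{n-1}(p',q')\ne\emptyset$, let $t=B(p',q',\alpha_n)$; if $t$ is an integer with $t\ge1$, insert $(p',q',t)$ into $L_n(p'+t,q'+t\alpha_n)$. *)

theory Defs
  imports Complex_Main "HOL-Library.Multiset" "Graph_Theory.Digraph"
begin

definition tournament :: "('a, 'b) pre_digraph \<Rightarrow> bool" where
  "tournament G \<longleftrightarrow> digraph G \<and>
     (\<forall>u\<in>verts G. \<forall>v\<in>verts G. u \<noteq> v \<longrightarrow> (u \<rightarrow>\<^bsub>G\<^esub> v) \<noteq> (v \<rightarrow>\<^bsub>G\<^esub> u))"

definition score_sequence :: "('a, 'b) pre_digraph \<Rightarrow> nat list" where
  "score_sequence G =
     sorted_list_of_multiset (image_mset (out_degree G) (mset_set (verts G)))"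

text \<open>
  A score set with \<open>n\<close> elements is given by its increasing enumeration
  \<open>\<alpha> 1 < \<dots> < \<alpha> n\<close>, and the multiplicities by \<open>x 1, \<dots>, x n\<close>; values at other indices are
  irrelevant. Taking natural numbers as vertices and pairs of them as arcs is no restriction:
  every finite digraph without parallel arcs is isomorphic to one of this type.
\<close>

definition correct_score_sequence :: "nat \<Rightarrow> (nat \<Rightarrow> nat) \<Rightarrow> (nat \<Rightarrow> nat) \<Rightarrow> bool" where
  "correct_score_sequence n \<alpha> x \<longleftrightarrow>
     (\<exists>G :: (nat, nat \<times> nat) pre_digraph. tournament G \<and>
        score_sequence G = concat (map (\<lambda>i. replicate (x i) (\<alpha> i)) [1..<Suc n]))"

definition bound_B :: "nat \<Rightarrow> nat \<Rightarrow> nat \<Rightarrow> real" where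
  "bound_B p' q' a = (let h = 2 * (real a - real p') + 1 in
     (h + sqrt (h\<^sup>2 + 8 * (real q' - real p' * (real p' - 1) / 2))) / 2)"

definition cells :: "(nat \<Rightarrow> nat) \<Rightarrow> nat \<Rightarrow> (nat \<times> nat) set" where
  "cells \<alpha> k = {0..2 * \<alpha> k + 1} \<times> {0..(2 * \<alpha> k + 1) * \<alpha> k}"

text \<open>
  The cell \<open>L\<^sub>k(p, q)\<close> is the set of all triples inserted into it. Level \<open>k\<close> only reads the
  completed level \<open>k - 1\<close>, so the order of the insertions does not matter. No range condition is
  imposed on the target cell of an insertion: it always lies in the table, as shown in
  \<open>net_in_cells\<close> below.
\<close>

primrec first_part :: "(nat \<Rightarrow> nat) \<Rightarrow> nat \<Rightarrow> nat \<Rightarrow> nat \<Rightarrow> (nat \<times> nat \<times> nat) set" where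
  "first_part \<alpha> 0 = (\<lambda>p q. if p = 0 \<and> q = 0 then {(0, 0, 0)} else {})"
| "first_part \<alpha> (Suc l) = (\<lambda>p q. {(p', q', x) | p' q' x.
     1 \<le> x \<and> x \<le> 2 * \<alpha> (Suc l) + 1 \<and>
     (p', q') \<in> cells \<alpha> l \<and> first_part \<alpha> l p' q' \<noteq> {} \<and>
     real x \<le> bound_B p' q' (\<alpha> (Suc l)) \<and>
     p = p' + x \<and> q = q' + x * \<alpha> (Suc l)})"

definition second_part :: "(nat \<Rightarrow> nat) \<Rightarrow> nat \<Rightarrow> nat \<Rightarrow> nat \<Rightarrow> (nat \<times> nat \<times> nat) set" where
  "second_part \<alpha> n = (\<lambda>p q. {(p', q', t) | p' q' t.
     (p', q') \<in> cells \<alpha> (n - 1) \<and> first_part \<alpha> (n - 1) p' q' \<noteq> {} \<and>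
     real t = bound_B p' q' (\<alpha> n) \<and> 1 \<le> t \<and>
     p = p' + t \<and> q = q' + t * \<alpha> n})"

text \<open>\<open>net n \<alpha> k p q\<close> is the cell \<open>L\<^sub>k(p, q)\<close>, for \<open>0 \<le> k \<le> n\<close>.\<close>

definition net :: "nat \<Rightarrow> (nat \<Rightarrow> nat) \<Rightarrow> nat \<Rightarrow> nat \<Rightarrow> nat \<Rightarrow> (nat \<times> nat \<times> nat) set" where
  "net n \<alpha> k = (if k < n then first_part (\<alpha>(0 := 0)) k else second_part (\<alpha>(0 := 0)) n)"

lemma insertion_bound:
  assumes "real x \<le> bound_B p q a" "p * (p - 1) \<le> 2 * q"
  shows "(p + x) * (p + x - 1) \<le> 2 * (q + x * a)"
proof -
  define h where "h = 2 * (real a - real p) + 1"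
  define d where "d = real q - real p * (real p - 1) / 2"
  have pred: "real (m * (m - 1)) = real m * (real m - 1)" for m :: nat
    by (cases m) (auto simp: algebra_simps)
  have "real (p * (p - 1)) \<le> real (2 * q)" using assms(2) by (rule of_nat_mono)
  then have d: "d \<ge> 0" unfolding pred d_def by simp
  have le: "2 * real x - h \<le> sqrt (h\<^sup>2 + 8 * d)"
    using assms(1) by (simp add: bound_B_def Let_def h_def d_def)
  have "real x * real x - h * real x \<le> 2 * d"
  proof (cases "2 * real x - h \<ge> 0")
    case True
    then have "(2 * real x - h)\<^sup>2 \<le> (sqrt (h\<^sup>2 + 8 * d))\<^sup>2"
      using le by (intro power_mono)
    also have "\<dots> = h\<^sup>2 + 8 * d" using d by simp
    finally show ?thesis by (simp add: power2_eq_square algebra_simps)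
  next
    case False
    then have "real x * (real x - h) \<le> 0" by (intro mult_nonneg_nonpos) auto
    then show ?thesis using d by (simp add: algebra_simps)
  qed
  then have "real ((p + x) * (p + x - 1)) \<le> real (2 * (q + x * a))"
    unfolding pred h_def d_def by (simp add: field_simps)
  then show ?thesis by (simp only: of_nat_le_iff)
qed

lemma cells_bound:
  assumes "p * (p - 1) \<le> 2 * q" "q \<le> p * \<alpha> k"
  shows "(p, q) \<in> cells \<alpha> k"
proof -
  have "p * (p - 1) \<le> p * (2 * \<alpha> k)" using assms by linarith
  then have p: "p \<le> 2 * \<alpha> k + 1" by auto
  with assms(2) have "q \<le> (2 * \<alpha> k + 1) * \<alpha> k"
    using mult_le_mono1 order_trans by blast
  with p show ?thesis by (simp add: cells_def)
qed

lemma first_part_bound: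
  assumes "first_part \<alpha> k p q \<noteq> {}" "\<And>i. i < k \<Longrightarrow> \<alpha> i \<le> \<alpha> (Suc i)"
  shows "p * (p - 1) \<le> 2 * q \<and> q \<le> p * \<alpha> k"
  using assms
proof (induction k arbitrary: p q)
  case 0
  then show ?case by (auto split: if_splits)
next
  case (Suc k)
  then obtain p' q' x where *: "first_part \<alpha> k p' q' \<noteq> {}" "real x \<le> bound_B p' q' (\<alpha> (Suc k))"
    "p = p' + x" "q = q' + x * \<alpha> (Suc k)" by auto
  have IH: "p' * (p' - 1) \<le> 2 * q'" "q' \<le> p' * \<alpha> k"
    using Suc.IH[OF *(1)] Suc.prems(2) by auto
  have "q' \<le> p' * \<alpha> (Suc k)"
    using IH(2) Suc.prems(2)[of k] by (meson lessI mult_le_mono2 order_trans)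
  then show ?case
    using insertion_bound[OF *(2) IH(1)] *(3,4) by (simp add: algebra_simps)
qed

lemma net_in_cells:
  assumes "n \<ge> 1" "strict_mono_on {1..n} \<alpha>" "k \<le> n" "net n \<alpha> k p q \<noteq> {}"
  shows "(p, q) \<in> cells (\<alpha>(0 := 0)) k"
proof -
  let ?\<alpha> = "\<alpha>(0 := 0)"
  have mono: "?\<alpha> i \<le> ?\<alpha> (Suc i)" if "i < n" for i
    using that strict_mono_onD[OF assms(2), of i "Suc i"] by (cases i) auto
  have "p * (p - 1) \<le> 2 * q \<and> q \<le> p * ?\<alpha> k"
  proof (cases "k < n")
    case True
    then show ?thesis
      using assms(4) mono first_part_bound[of ?\<alpha> k p q] by (simp add: net_def)
  next
    case False
    with assms have [simp]: "k = n" by simp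
    have "second_part ?\<alpha> n p q \<noteq> {}" using assms(4) by (simp add: net_def)
    then obtain p' q' t where *: "first_part ?\<alpha> (n - 1) p' q' \<noteq> {}" "real t \<le> bound_B p' q' (?\<alpha> n)"
      "p = p' + t" "q = q' + t * ?\<alpha> n"
      unfolding second_part_def by (blast intro: eq_refl)
    have b: "p' * (p' - 1) \<le> 2 * q'" "q' \<le> p' * ?\<alpha> (n - 1)"
      using first_part_bound[OF *(1)] mono by auto
    have "?\<alpha> (n - 1) \<le> ?\<alpha> n" using mono[of "n - 1"] assms(1) by simp
    then have "q' \<le> p' * ?\<alpha> n" using b(2) by (meson mult_le_mono2 order_trans)
    then show ?thesis
      using insertion_bound[OF *(2) b(1)] *(3,4) by (simp add: algebra_simps)
  qed
  then show ?thesis by (intro cells_bound) auto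
qed

end

theory Submission
  imports Defs
begin

text \<open>
  Since \<open>bound_B\<close> is the only positive root of a quadratic, lying in the net means
  \<open>p\<^sub>i (p\<^sub>i - 1) \<le> 2 q\<^sub>i\<close> for all \<open>i\<close>, with equality for \<open>i = n\<close>. These are
  Landau's conditions at the ends of the blocks of equal scores; in between they follow because
  \<open>k (k - 1)\<close> is convex in \<open>k\<close> while the partial sums of the scores are affine on each block.

  For the existence of a tournament with prescribed scores, take one that minimises the sum of
  the differences between actual and prescribed scores. If some score is too large, then
  reversing a path to a vertex whose score is too small would improve it; if there is no such
  path, the set of vertices reachable from that vertex violates Landau's condition.
\<close>

section \<open>Tournaments as relations, and counting arcs inside a vertex set\<close>

text \<open>As a relation, a tournament can be changed one pair at a time. Asymmetry rules out
  loops, and since related vertices lie in \<open>V\<close>, scores can be defined without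
  mentioning \<open>V\<close>.\<close>

definition tournament_on :: "'a set \<Rightarrow> ('a \<Rightarrow> 'a \<Rightarrow> bool) \<Rightarrow> bool" where
  "tournament_on V T \<longleftrightarrow> (\<forall>u v. T u v \<longrightarrow> u \<in> V \<and> v \<in> V \<and> \<not> T v u) \<and>
     (\<forall>u\<in>V. \<forall>v\<in>V. u \<noteq> v \<longrightarrow> T u v \<or> T v u)"

definition score :: "('a \<Rightarrow> 'a \<Rightarrow> bool) \<Rightarrow> 'a \<Rightarrow> nat" where
  "score T v = card {w. T v w}"

lemma finite_out_neighbours:
  assumes "tournament_on V T" "finite V"
  shows "finite {w. T v w}"
  using assms by (auto simp: tournament_on_def intro: finite_subset[of _ V])

text \<open>Double counting: the 0/1 sum over \<open>U\<close> and its transpose add up to one for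
  each ordered pair of distinct vertices.\<close>

lemma arcs_inside:
  assumes "tournament_on V T" "U \<subseteq> V" "finite U"
  shows "2 * (\<Sum>v\<in>U. card {w\<in>U. T v w}) = card U * (card U - 1)"
proof -
  let ?f = "\<lambda>v w. if T v w then 1 else 0 :: nat"
  have "card {w\<in>U. T v w} = (\<Sum>w\<in>U. ?f v w)" for v
    using assms(3) by (simp add: sum.If_cases Int_def)
  then have "2 * (\<Sum>v\<in>U. card {w\<in>U. T v w}) = (\<Sum>v\<in>U. \<Sum>w\<in>U. ?f v w) + (\<Sum>v\<in>U. \<Sum>w\<in>U. ?f v w)"
    by simp
  also have "\<dots> = (\<Sum>v\<in>U. \<Sum>w\<in>U. ?f v w) + (\<Sum>v\<in>U. \<Sum>w\<in>U. ?f w v)"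
    using sum.swap[of ?f U U] by simp
  also have "\<dots> = (\<Sum>v\<in>U. \<Sum>w\<in>U. ?f v w + ?f w v)"
    by (simp add: sum.distrib)
  also have "\<dots> = (\<Sum>v\<in>U. card (U - {v}))"
  proof (rule sum.cong[OF refl])
    fix v assume v: "v \<in> U"
    have "(\<Sum>w\<in>U. ?f v w + ?f w v) = (\<Sum>w\<in>U. if w \<in> U - {v} then 1 else 0)"
    proof (rule sum.cong[OF refl])
      fix w assume w: "w \<in> U"
      have "T v w \<longrightarrow> \<not> T w v" "w \<noteq> v \<longrightarrow> T v w \<or> T w v"
        using assms(1,2) v w unfolding tournament_on_def by blast+
      then show "?f v w + ?f w v = (if w \<in> U - {v} then 1 else 0)"
        using w by auto
    qed
    also have "\<dots> = card (U - {v})"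
      using assms(3) by (subst sum.inter_restrict[symmetric]) (auto simp: Int_absorb1 Diff_subset)
    finally show "(\<Sum>w\<in>U. ?f v w + ?f w v) = card (U - {v})" .
  qed
  also have "\<dots> = card U * (card U - 1)"
    using assms(3) by simp
  finally show ?thesis .
qed

lemma sum_score_eq:
  assumes "tournament_on V T" "finite V"
  shows "2 * (\<Sum>v\<in>V. score T v) = card V * (card V - 1)"
proof -
  have "{w. T v w} = {w\<in>V. T v w}" for v
    using assms by (auto simp: tournament_on_def)
  then show ?thesis
    using arcs_inside[OF assms(1) subset_refl assms(2)] by (simp add: score_def)
qed

text \<open>Arcs inside \<open>U\<close> alone account for the left-hand side; arcs leaving
  \<open>U\<close> only add to the scores.\<close>

lemma sum_score_ge:
  assumes "tournament_on V T" "finite V" "U \<subseteq> V"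
  shows "card U * (card U - 1) \<le> 2 * (\<Sum>v\<in>U. score T v)"
proof -
  have "(\<Sum>v\<in>U. card {w\<in>U. T v w}) \<le> (\<Sum>v\<in>U. score T v)"
    unfolding score_def
    by (intro sum_mono card_mono finite_out_neighbours[OF assms(1,2)]) auto
  then show ?thesis
    using arcs_inside[OF assms(1,3)] finite_subset[OF assms(3,2)] by simp
qed

section \<open>Path reversal and the existence half of Landau's theorem\<close>

text \<open>Induction on the path: the tail is reversed first, then the arc from \<open>a\<close> to
  \<open>v\<close>. As start of the tail \<open>v\<close> loses one arc, and the flipped arc gives
  it back, so only the two ends of the path change their scores. On a one-vertex path the two
  corrections cancel.\<close>

lemma reverse_path:
  assumes "tournament_on V T" "finite V" "distinct (a # vs)" "successively T (a # vs)"
  shows "\<exists>T'. tournament_on V T' \<and>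
    (\<forall>u w. u \<notin> set (a # vs) \<or> w \<notin> set (a # vs) \<longrightarrow> T' u w = T u w) \<and>
    (\<forall>w. int (score T' w) = int (score T w) - of_bool (w = a) + of_bool (w = last (a # vs)))"
  using assms(3,4)
proof (induction vs arbitrary: a)
  case Nil
  then show ?case using assms(1) by (intro exI[of _ T]) auto
next
  case (Cons v vs)
  then obtain T' where T': "tournament_on V T'"
    and agree: "\<And>u w. u \<notin> set (v # vs) \<or> w \<notin> set (v # vs) \<Longrightarrow> T' u w = T u w"
    and sc: "\<And>w. int (score T' w) = int (score T w) - of_bool (w = v) + of_bool (w = last (v # vs))"
    by (metis distinct.simps(2) successively.simps(3))
  \<comment> \<open>Distinctness keeps \<open>a\<close> off the tail, so reversing the tail has not
    touched this arc; the agreement clause is carried through the induction for this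
    purpose.\<close>
  have av: "T' a v" "a \<noteq> v" using Cons.prems agree[of a v] by auto
  define S where "S u w \<longleftrightarrow> (u = v \<and> w = a) \<or> (T' u w \<and> \<not> (u = a \<and> w = v))" for u w
  have "\<not> T' v a" "a \<in> V" "v \<in> V" using T' av by (auto simp: tournament_on_def)
  have fin: "finite {w. T' u w}" for u by (rule finite_out_neighbours[OF T' assms(2)])
  have S: "tournament_on V S"
    unfolding tournament_on_def
  proof (intro conjI allI ballI impI)
    fix u w assume "S u w"
    then show "u \<in> V" "w \<in> V" "\<not> S w u"
      using T' av \<open>\<not> T' v a\<close> \<open>a \<in> V\<close> \<open>v \<in> V\<close> by (auto simp: tournament_on_def S_def)
  next
    fix u w assume "u \<in> V" "w \<in> V" "u \<noteq> w"
    then have "T' u w \<or> T' w u" using T' by (auto simp: tournament_on_def)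
    then show "S u w \<or> S w u" by (auto simp: S_def)
  qed
  have "{w. S a w} = {w. T' a w} - {v}" "{w. S v w} = insert a {w. T' v w}"
    using av by (auto simp: S_def)
  then have a: "score T' a = Suc (score S a)" and v: "score S v = Suc (score T' v)"
    using fin av \<open>\<not> T' v a\<close> by (simp_all add: score_def card_Suc_Diff1 del: card_Diff_insert)
  have other: "score S w = score T' w" if "w \<noteq> a" "w \<noteq> v" for w
    using that by (auto simp: score_def S_def)
  have "int (score S w) = int (score T w) - of_bool (w = a) + of_bool (w = last (a # v # vs))" for w
    using sc[of w] a v other[of w] av(2) by (cases "w = a"; cases "w = v") auto
  moreover have "S u w = T u w" if "u \<notin> set (a # v # vs) \<or> w \<notin> set (a # v # vs)" for u w
    using that agree[of u w] by (auto simp: S_def)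
  ultimately show ?case using S by blast
qed

theorem Landau_existence:
  fixes V :: "'a::linorder set" and s :: "'a \<Rightarrow> nat"
  assumes "finite V"
    and sub: "\<And>U. U \<subseteq> V \<Longrightarrow> card U * (card U - 1) \<le> 2 * sum s U"
    and tot: "card V * (card V - 1) = 2 * sum s V"
  shows "\<exists>T. tournament_on V T \<and> (\<forall>v\<in>V. score T v = s v)"
proof -
  define \<Phi> where "\<Phi> T = (\<Sum>v\<in>V. nat \<bar>int (score T v) - int (s v)\<bar>)" for T
  \<comment> \<open>The linear order supplies a first tournament, so a minimiser of
    \<open>\<Phi>\<close> exists.\<close>
  have "tournament_on V (\<lambda>u v. u \<in> V \<and> v \<in> V \<and> u < v)"
    by (auto simp: tournament_on_def)
  then obtain T where T: "tournament_on V T"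
    and least: "\<And>T'. tournament_on V T' \<Longrightarrow> \<Phi> T \<le> \<Phi> T'"
    using ex_has_least_nat[of "tournament_on V" _ \<Phi>] by blast
  have eq: "sum (score T) V = sum s V"
    using sum_score_eq[OF T assms(1)] tot by simp
  \<comment> \<open>One inequality is enough: as the totals agree, it forces equality at every
    vertex.\<close>
  have "score T v \<le> s v" if "v \<in> V" for v
  proof (rule ccontr)
    assume v: "\<not> score T v \<le> s v"
    define R where "R = {w. \<exists>vs. distinct (v # vs) \<and> successively T (v # vs) \<and> last (v # vs) = w}"
    have R_I: "w \<in> R" if "distinct (v # vs)" "successively T (v # vs)" "last (v # vs) = w" for vs w
      unfolding R_def using that by blast
    have vR: "v \<in> R" by (rule R_I[of "[]"]) auto
    have closed: "w' \<in> R" if wR: "w \<in> R" and ww': "T w w'" for w w'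
    proof -
      obtain vs where vs: "distinct (v # vs)" "successively T (v # vs)" "last (v # vs) = w"
        using wR unfolding R_def by blast
      \<comment> \<open>Paths in \<open>R\<close> must stay distinct to be reversible. If
        \<open>w'\<close> already lies on the path, the path is cut off there; otherwise
        \<open>w'\<close> is appended.\<close>
      show ?thesis
      proof (cases "w' \<in> set (v # vs)")
        case True
        then obtain ys zs where split: "v # vs = (ys @ [w']) @ zs"
          by (metis append.assoc append_Cons append_Nil in_set_conv_decomp)
        then obtain us where us: "ys @ [w'] = v # us"
          by (cases ys) auto
        have "distinct (v # us)" "successively T (v # us)"
          using vs(1,2) unfolding split us by (auto simp: successively_append_iff simp del: append_Cons)
        moreover have "last (v # us) = w'" using us by (metis last_snoc)
        ultimately show ?thesis by (rule R_I)
      next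
        case False
        have "successively T ((v # vs) @ [w'])"
          using vs(2,3) ww' by (subst successively_append_iff) auto
        then show ?thesis
          using vs(1) False by (intro R_I[of "vs @ [w']"]) auto
      qed
    qed
    have RV: "R \<subseteq> V"
    proof
      fix w assume "w \<in> R"
      then obtain vs where vs: "successively T (v # vs)" "last (v # vs) = w"
        unfolding R_def by blast
      have "set (v # vs) \<subseteq> V"
        using vs(1) that
      proof (induction vs arbitrary: v)
        case (Cons u us)
        then show ?case using T by (auto simp: tournament_on_def)
      qed auto
      then show "w \<in> V" using vs(2) by (metis last_in_set list.distinct(1) subsetD)
    qed
    \<comment> \<open>A deficient \<open>w\<close> in \<open>R\<close> would contradict minimality:
      reversing the path from \<open>v\<close> to \<open>w\<close> moves one unit of score from a
      vertex with too much to one with too little.\<close>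
    have "s w \<le> score T w" if wR: "w \<in> R" for w
    proof (rule ccontr)
      assume w: "\<not> s w \<le> score T w"
      then have "w \<noteq> v" using v by auto
      obtain vs where vs: "distinct (v # vs)" "successively T (v # vs)" "last (v # vs) = w"
        using wR unfolding R_def by blast
      obtain T' where T': "tournament_on V T'"
        and sc: "\<And>u. int (score T' u) = int (score T u) - of_bool (u = v) + of_bool (u = w)"
        using reverse_path[OF T assms(1) vs(1,2)] unfolding vs(3) by blast
      have "\<Phi> T' < \<Phi> T"
        unfolding \<Phi>_def
      proof (rule sum_strict_mono_ex1[OF assms(1)])
        show "\<forall>u\<in>V. nat \<bar>int (score T' u) - int (s u)\<bar> \<le> nat \<bar>int (score T u) - int (s u)\<bar>"
          using v w by (auto simp: sc)
        show "\<exists>u\<in>V. nat \<bar>int (score T' u) - int (s u)\<bar> < nat \<bar>int (score T u) - int (s u)\<bar>"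
          using v \<open>v \<in> V\<close> \<open>w \<noteq> v\<close> by (intro bexI[of _ v]) (auto simp: sc)
      qed
      then show False using least[OF T'] by simp
    qed
    then have "sum s R < (\<Sum>u\<in>R. score T u)"
      using vR v finite_subset[OF RV assms(1)] by (intro sum_strict_mono_ex1) (auto intro!: bexI[of _ v])
    \<comment> \<open>No arc leaves \<open>R\<close>, so the scores over \<open>R\<close> count
      exactly the arcs inside it, and the prescribed sum is then too small for
      \<open>sub\<close>.\<close>
    also have "\<dots> = (\<Sum>u\<in>R. card {w\<in>R. T u w})"
      unfolding score_def by (intro sum.cong refl arg_cong[of _ _ card]) (auto intro: closed)
    finally show False
      using arcs_inside[OF T RV finite_subset[OF RV assms(1)]] sub[OF RV] by simp
  qed
  then have "score T v = s v" if "v \<in> V" for v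
    using eq that assms(1) by (metis (mono_tags, lifting) sum_mono_inv)
  then show ?thesis using T by blast
qed

section \<open>The bound of the algorithm as the root of a quadratic\<close>

lemma real_pred_mult: "real (m * (m - 1)) = real m * (real m - 1)"
  by (cases m) (auto simp: algebra_simps)

text \<open>With \<open>h\<close> and \<open>d\<close> as in the proof,
  \<open>(p + x) * (p + x - 1) - 2 * (q + x * a)\<close> is the quadratic
  \<open>x * x - h * x - 2 * d\<close>, with roots \<open>(h + r) / 2\<close> and
  \<open>(h - r) / 2\<close>. The first hypothesis gives \<open>d \<ge> 0\<close>, so for positive
  \<open>x\<close> the sign depends only on the position relative to the larger root.\<close>

lemma bound_B_iff:
  assumes "p * (p - 1) \<le> 2 * q" "x \<ge> 1"
  shows "real x \<le> bound_B p q a \<longleftrightarrow> (p + x) * (p + x - 1) \<le> 2 * (q + x * a)"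
    and "real x = bound_B p q a \<longleftrightarrow> (p + x) * (p + x - 1) = 2 * (q + x * a)"
proof -
  define h where "h = 2 * (real a - real p) + 1"
  define d where "d = real q - real p * (real p - 1) / 2"
  define r where "r = sqrt (h\<^sup>2 + 8 * d)"
  have "real (p * (p - 1)) \<le> real (2 * q)" using assms(1) by (rule of_nat_mono)
  then have d: "d \<ge> 0" unfolding real_pred_mult d_def by simp
  then have r2: "r\<^sup>2 = h\<^sup>2 + 8 * d" by (simp add: r_def)
  have "\<bar>h\<bar> \<le> r" unfolding r_def using d by (intro real_le_rsqrt) simp
  \<comment> \<open>The other root of the quadratic is nonpositive.\<close>
  then have pos: "2 * real x - h + r > 0" using assms(2) by linarith
  have B: "bound_B p q a = (h + r) / 2"
    by (simp add: bound_B_def Let_def h_def d_def r_def)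
  have "(2 * real x - h - r) * (2 * real x - h + r) = 4 * real x * real x - 4 * h * real x + h\<^sup>2 - r\<^sup>2"
    by (simp add: power2_eq_square algebra_simps)
  also have "\<dots> = 4 * (real x * real x - h * real x - 2 * d)"
    unfolding r2 by simp
  also have "\<dots> = 4 * (real ((p + x) * (p + x - 1)) - real (2 * (q + x * a)))"
    unfolding real_pred_mult h_def d_def by (simp add: field_simps)
  finally have key: "(2 * real x - h - r) * (2 * real x - h + r) =
    4 * (real ((p + x) * (p + x - 1)) - real (2 * (q + x * a)))" .
  have "real x \<le> bound_B p q a \<longleftrightarrow> 2 * real x - h - r \<le> 0"
    unfolding B by auto
  also have "\<dots> \<longleftrightarrow> (2 * real x - h - r) * (2 * real x - h + r) \<le> 0"
    using pos by (simp add: mult_le_0_iff)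
  also have "\<dots> \<longleftrightarrow> real ((p + x) * (p + x - 1)) \<le> real (2 * (q + x * a))"
    unfolding key by auto
  finally show "real x \<le> bound_B p q a \<longleftrightarrow> (p + x) * (p + x - 1) \<le> 2 * (q + x * a)"
    by (simp only: of_nat_le_iff)
  have "real x = bound_B p q a \<longleftrightarrow> 2 * real x - h - r = 0"
    unfolding B by auto
  also have "\<dots> \<longleftrightarrow> (2 * real x - h - r) * (2 * real x - h + r) = 0"
    using pos by simp
  also have "\<dots> \<longleftrightarrow> real ((p + x) * (p + x - 1)) = real (2 * (q + x * a))"
    unfolding key by auto
  finally show "real x = bound_B p q a \<longleftrightarrow> (p + x) * (p + x - 1) = 2 * (q + x * a)"
    by (simp only: of_nat_eq_iff)
qed

section \<open>Passing between digraphs and relations\<close>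

text \<open>\<open>out_degree\<close> counts arcs, \<open>score\<close> counts out-neighbours;
  without parallel arcs \<open>head G\<close> is a bijection between the two.\<close>

lemma tournament_on_dominates:
  assumes "tournament G"
  shows "tournament_on (verts G) (dominates G)"
    and "score (dominates G) v = out_degree G v"
proof -
  interpret digraph G using assms by (simp add: tournament_def)
  show "tournament_on (verts G) (dominates G)"
    unfolding tournament_on_def
  proof (intro conjI allI ballI impI)
    fix u w assume uw: "u \<rightarrow>\<^bsub>G\<^esub> w"
    then show "u \<in> verts G" "w \<in> verts G" by (auto dest: adj_in_verts)
    moreover have "u \<noteq> w" using uw adj_not_same by blast
    ultimately show "\<not> w \<rightarrow>\<^bsub>G\<^esub> u" using assms uw unfolding tournament_def by blast
  next
    fix u w assume "u \<in> verts G" "w \<in> verts G" "u \<noteq> w"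
    then show "u \<rightarrow>\<^bsub>G\<^esub> w \<or> w \<rightarrow>\<^bsub>G\<^esub> u" using assms unfolding tournament_def by blast
  qed
  have "inj_on (head G) (out_arcs G v)"
    by (rule inj_onI) (auto intro: no_multi_arcs simp: arc_to_ends_def)
  moreover have "head G ` out_arcs G v = {w. v \<rightarrow>\<^bsub>G\<^esub> w}"
    by (auto simp: arcs_ends_conv image_iff)
  ultimately show "score (dominates G) v = out_degree G v"
    unfolding score_def out_degree_def by (metis card_image)
qed

lemma tournament_of_tournament_on:
  assumes "tournament_on V T" "finite V"
  defines "G \<equiv> \<lparr>verts = V, arcs = {(u, v). T u v}, tail = fst, head = snd\<rparr>"
  shows "tournament G" and "out_degree G v = score T v"
proof -
  have "{(u, v). T u v} \<subseteq> V \<times> V" using assms(1) by (auto simp: tournament_on_def)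
  then have fin: "finite {(u, v). T u v}" using assms(2) by (meson finite_SigmaI finite_subset)
  have "digraph G"
    using assms(1,2) fin
    by unfold_locales (unfold G_def tournament_on_def arc_to_ends_def, auto, blast)
  moreover have dom: "u \<rightarrow>\<^bsub>G\<^esub> w \<longleftrightarrow> T u w" for u w
    by (force simp: G_def arcs_ends_conv)
  moreover have "verts G = V" by (simp add: G_def)
  ultimately show "tournament G"
    using assms(1) unfolding tournament_def tournament_on_def by blast
  then show "out_degree G v = score T v"
    using tournament_on_dominates(2)[of G v] dom by (simp add: score_def)
qed

section \<open>Lower bounds for score sums, and convexity within a block\<close>

text \<open>Each \<open>s v - a\<close> with \<open>v\<close> in \<open>U\<close> is at least its
  negative part, and the negative parts outside \<open>U\<close> only lower the bound. The bound
  depends on \<open>U\<close> only through \<open>card U\<close>; for \<open>a\<close> the score at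
  position \<open>card U\<close> in sorted order it is the sum of the \<open>card U\<close> smallest
  scores, so no sorting of \<open>U\<close> is needed.\<close>

lemma sum_subset_ge:
  fixes s :: "'a \<Rightarrow> int"
  assumes "finite V" "U \<subseteq> V"
  shows "int (card U) * a + (\<Sum>v\<in>V. min 0 (s v - a)) \<le> (\<Sum>v\<in>U. s v)"
proof -
  have "(\<Sum>v\<in>V. min 0 (s v - a)) = (\<Sum>v\<in>U. min 0 (s v - a)) + (\<Sum>v\<in>V - U. min 0 (s v - a))"
    using assms by (simp add: sum.subset_diff)
  also have "\<dots> \<le> (\<Sum>v\<in>U. s v - a) + 0"
    by (intro add_mono sum_mono sum_nonpos) auto
  finally show ?thesis by (simp add: sum_subtractf)
qed

lemma concave_between:
  fixes a k p q x :: int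
  assumes "p * (p - 1) \<le> 2 * q" "(p + x) * (p + x - 1) \<le> 2 * (q + x * a)" "p \<le> k" "k \<le> p + x"
  shows "k * (k - 1) \<le> 2 * (q + (k - p) * a)"
proof -
  define y where "y = k - p"
  define f where "f t = 2 * (q + t * a) - (p + t) * (p + t - 1)" for t
  have y: "0 \<le> y" "y \<le> x" using assms by (auto simp: y_def)
  have f: "0 \<le> f 0" "0 \<le> f x" using assms by (auto simp: f_def)
  \<comment> \<open>\<open>f\<close> is quadratic with leading coefficient -1, so it exceeds its
    chord over the interval from 0 to \<open>x\<close> by \<open>y * (x - y)\<close>; multiplying by
    \<open>x\<close> avoids division.\<close>
  have "x * f y = (x - y) * f 0 + y * f x + x * y * (x - y)"
    by (simp add: f_def algebra_simps)
  also have "0 \<le> \<dots>" using y f by simp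
  finally have *: "0 \<le> x * f y" .
  have "0 \<le> f y"
  proof (cases "x = 0")
    case True
    then show ?thesis using y f by simp
  next
    case False
    then show ?thesis using * y by (simp add: zero_le_mult_iff)
  qed
  then show ?thesis by (simp add: f_def y_def)
qed

section \<open>Score lists made of blocks of equal scores\<close>

abbreviation blocks :: "nat \<Rightarrow> (nat \<Rightarrow> nat) \<Rightarrow> (nat \<Rightarrow> nat) \<Rightarrow> nat list" where
  "blocks n \<alpha> x \<equiv> concat (map (\<lambda>i. replicate (x i) (\<alpha> i)) [1..<Suc n])"

lemma sum_mset_blocks:
  fixes g :: "nat \<Rightarrow> 'b::comm_semiring_1"
  shows "(\<Sum>y\<in>#mset (blocks n \<alpha> x). g y) = (\<Sum>j=1..n. of_nat (x j) * g (\<alpha> j))"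
  by (induction n) (auto simp: algebra_simps)

text \<open>Rewrites a vertex sum depending only on scores as a weighted sum over the distinct
  scores. Constant 1 yields cardinalities, the identity yields score sums, and integer values serve
  the threshold bound.\<close>

lemma sum_blocks:
  fixes g :: "nat \<Rightarrow> 'b::comm_semiring_1"
  assumes "image_mset s (mset_set V) = mset (blocks n \<alpha> x)"
  shows "(\<Sum>v\<in>V. g (s v)) = (\<Sum>j=1..n. of_nat (x j) * g (\<alpha> j))"
proof -
  have "(\<Sum>v\<in>V. g (s v)) = (\<Sum>y\<in>#image_mset s (mset_set V). g y)"
    by (simp add: sum_unfold_sum_mset image_mset.compositionality comp_def)
  then show ?thesis unfolding assms sum_mset_blocks .
qed

lemma sorted_blocks:
  assumes "strict_mono_on {1..n} \<alpha>"
  shows "sorted (blocks n \<alpha> x)"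
  using assms
proof (induction n)
  case (Suc n)
  have "strict_mono_on {1..n} \<alpha>"
    using Suc.prems by (auto simp: strict_mono_on_def)
  moreover have "\<alpha> i \<le> \<alpha> (Suc n)" if "i \<in> {1..n}" for i
    using strict_mono_onD[OF Suc.prems, of i "Suc n"] that by auto
  ultimately show ?case using Suc.IH by (auto simp: sorted_append)
qed auto

lemma score_sequence_eq_iff:
  assumes "sorted xs"
  shows "score_sequence G = xs \<longleftrightarrow> image_mset (out_degree G) (mset_set (verts G)) = mset xs"
  unfolding score_sequence_def using assms
  by (metis mset_sorted_list_of_multiset sorted_list_of_multiset_mset sorted_sort_id)

section \<open>Landau's conditions at the block ends\<close>

lemma correct_score_sequence_iff:
  assumes "n \<ge> 1" and mono: "strict_mono_on {1..n} \<alpha>"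
    and p: "\<forall>i. p i = (\<Sum>j=1..i. x j)"
    and q: "\<forall>i. q i = (\<Sum>j=1..i. \<alpha> j * x j)"
  shows "correct_score_sequence n \<alpha> x \<longleftrightarrow>
    (\<forall>i\<in>{1..n}. p i * (p i - 1) \<le> 2 * q i) \<and> p n * (p n - 1) = 2 * q n"
    (is "?L \<longleftrightarrow> ?R")
proof
  have cmp: "\<alpha> j \<le> \<alpha> i \<longleftrightarrow> j \<le> i" if "i \<in> {1..n}" "j \<in> {1..n}" for i j
    using strict_mono_on_less_eq[OF mono that(2,1)] .
  {
    assume ?L
    then obtain G :: "(nat, nat \<times> nat) pre_digraph" where G: "tournament G"
      and "score_sequence G = blocks n \<alpha> x" by (auto simp: correct_score_sequence_def)
    then have ms: "image_mset (out_degree G) (mset_set (verts G)) = mset (blocks n \<alpha> x)"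
      using score_sequence_eq_iff[OF sorted_blocks[OF mono]] by blast
    interpret digraph G using G by (simp add: tournament_def)
    note T = tournament_on_dominates[OF G]
    \<comment> \<open>The union of the first \<open>i\<close> blocks: it has \<open>p i\<close>
      vertices and score sum \<open>q i\<close>, so the general inequality for \<open>U i\<close> is
      the condition at the end of block \<open>i\<close>.\<close>
    define U where "U i = {v \<in> verts G. out_degree G v \<le> \<alpha> i}" for i
    have sumU: "(\<Sum>v\<in>U i. g (out_degree G v)) = (\<Sum>j=1..i. x j * g (\<alpha> j))"
      if i: "i \<in> {1..n}" for i and g :: "nat \<Rightarrow> nat"
    proof -
      have "(\<Sum>v\<in>U i. g (out_degree G v)) =
          (\<Sum>v\<in>verts G. if out_degree G v \<le> \<alpha> i then g (out_degree G v) else 0)"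
        unfolding U_def by (rule sum.inter_filter) simp
      also have "\<dots> = (\<Sum>j=1..n. x j * (if \<alpha> j \<le> \<alpha> i then g (\<alpha> j) else 0))"
        using sum_blocks[OF ms, of "\<lambda>y. if y \<le> \<alpha> i then g y else 0"] by simp
      also have "\<dots> = (\<Sum>j=1..i. x j * (if \<alpha> j \<le> \<alpha> i then g (\<alpha> j) else 0))"
        using i by (intro sum.mono_neutral_right) (auto simp: cmp)
      also have "\<dots> = (\<Sum>j=1..i. x j * g (\<alpha> j))"
        using i by (intro sum.cong) (auto simp: cmp)
      finally show ?thesis .
    qed
    have cardU: "card (U i) = p i" if "i \<in> {1..n}" for i
      using sumU[OF that, of "\<lambda>_. 1"] p by simp
    have degU: "(\<Sum>v\<in>U i. out_degree G v) = q i" if "i \<in> {1..n}" for i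
      using sumU[OF that, of "\<lambda>y. y"] q by (simp add: mult.commute)
    have "p i * (p i - 1) \<le> 2 * q i" if "i \<in> {1..n}" for i
      using sum_score_ge[OF T(1) finite_verts, of "U i"] cardU[OF that] degU[OF that]
      by (auto simp: T(2) U_def)
    moreover have "card (verts G) = p n"
      using sum_blocks[OF ms, of "\<lambda>_. 1::nat"] p by simp
    moreover have "(\<Sum>v\<in>verts G. out_degree G v) = q n"
      using sum_blocks[OF ms, of "\<lambda>y. y"] q by (simp add: mult.commute)
    ultimately show ?R
      using sum_score_eq[OF T(1) finite_verts] by (simp add: T(2))
  }
  {
    assume R: ?R
    let ?xs = "blocks n \<alpha> x"
    \<comment> \<open>The vertices are the positions in the list, and the entry at a position is its
      prescribed score.\<close>
    define V where "V = {..<length ?xs}"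
    define s where "s = (!) ?xs"
    have fin: "finite V" by (simp add: V_def)
    have ms: "image_mset s (mset_set V) = mset ?xs"
    proof -
      have "mset_set V = mset [0..<length ?xs]" by (simp add: V_def lessThan_atLeast0)
      then have "image_mset s (mset_set V) = mset (map s [0..<length ?xs])" by simp
      then show ?thesis unfolding s_def map_nth .
    qed
    have cV: "card V = p n"
      using sum_blocks[OF ms, of "\<lambda>_. 1::nat"] p by simp
    have sV: "sum s V = q n"
      using sum_blocks[OF ms, of "\<lambda>y. y"] q by (simp add: mult.commute)
    have bnd: "p i * (p i - 1) \<le> 2 * q i" if "i \<le> n" for i
      using R that p by (cases "i = 0") auto
    have int_pred: "int (m * (m - 1)) = int m * (int m - 1)" for m :: nat
      by (cases m) (auto simp: algebra_simps)
    have ge: "card U * (card U - 1) \<le> 2 * sum s U" if U: "U \<subseteq> V" for U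
    proof -
      let ?k = "card U"
      have "?k \<le> p n" using card_mono[OF fin U] cV by simp
      then have ex: "?k \<le> p (Suc (n - 1))" using assms(1) by simp
      \<comment> \<open>Block \<open>Suc i\<close> is the one in which position
        \<open>card U\<close> falls. Counting from \<open>Suc i\<close> lets \<open>i = 0\<close>
        occur, where \<open>p 0 = 0\<close> gives the lower bound.\<close>
      define i where "i = (LEAST i. ?k \<le> p (Suc i))"
      have up: "?k \<le> p (Suc i)" unfolding i_def by (rule LeastI[of _ "n - 1"]) (rule ex)
      have "i \<le> n - 1" unfolding i_def by (rule Least_le) (rule ex)
      then have i: "Suc i \<in> {1..n}" using assms(1) by auto
      have lo: "p i \<le> ?k"
      proof (cases i)
        case 0
        then show ?thesis using p by simp
      next
        case (Suc j)
        then have "\<not> ?k \<le> p (Suc j)" using not_less_Least[of j "\<lambda>i. ?k \<le> p (Suc i)"] by (simp add: i_def)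
        then show ?thesis using Suc by simp
      qed
      let ?a = "int (\<alpha> (Suc i))"
      have Suc_p: "p (Suc i) = p i + x (Suc i)" and Suc_q: "q (Suc i) = q i + x (Suc i) * \<alpha> (Suc i)"
        using p q by simp_all
      \<comment> \<open>With the score of block \<open>Suc i\<close> as threshold, only the
        \<open>i\<close> earlier blocks lie below it and contribute.\<close>
      have "(\<Sum>v\<in>V. min 0 (int (s v) - ?a)) = (\<Sum>j=1..n. int (x j) * min 0 (int (\<alpha> j) - ?a))"
        using sum_blocks[OF ms, of "\<lambda>y. min 0 (int y - ?a)"] by simp
      also have "\<dots> = (\<Sum>j=1..i. int (x j) * min 0 (int (\<alpha> j) - ?a))"
        using i cmp[OF _ i] cmp[OF i] by (intro sum.mono_neutral_right) (auto simp: min_def)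
      also have "\<dots> = (\<Sum>j=1..i. int (x j) * (int (\<alpha> j) - ?a))"
        using i by (intro sum.cong refl) (auto simp: cmp min_absorb2)
      also have "\<dots> = int (q i) - int (p i) * ?a"
        using p q by (simp add: algebra_simps sum_subtractf sum_distrib_left)
      finally have "int (q i) + (int ?k - int (p i)) * ?a \<le> int (sum s U)"
        using sum_subset_ge[OF fin U, of ?a "\<lambda>v. int (s v)"] by (simp add: algebra_simps)
      \<comment> \<open>Within the block the lower bound is affine in \<open>card U\<close>, so the
        conditions at its two ends suffice.\<close>
      moreover have "int ?k * (int ?k - 1) \<le> 2 * (int (q i) + (int ?k - int (p i)) * ?a)"
      proof (rule concave_between[where x = "int (x (Suc i))"])
        have "int (p i * (p i - 1)) \<le> int (2 * q i)"
          using bnd[of i] i by (intro of_nat_mono) simp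
        then show "int (p i) * (int (p i) - 1) \<le> 2 * int (q i)" unfolding int_pred by simp
        have "int (p (Suc i) * (p (Suc i) - 1)) \<le> int (2 * q (Suc i))"
          using bnd[of "Suc i"] i by (intro of_nat_mono) simp
        then show "(int (p i) + int (x (Suc i))) * (int (p i) + int (x (Suc i)) - 1)
            \<le> 2 * (int (q i) + int (x (Suc i)) * ?a)"
          unfolding int_pred Suc_p Suc_q by simp
      qed (use lo up Suc_p in auto)
      ultimately have "int (?k * (?k - 1)) \<le> int (2 * sum s U)"
        unfolding int_pred by simp
      then show ?thesis by (simp only: of_nat_le_iff)
    qed
    have "card V * (card V - 1) = 2 * sum s V" using R cV sV by simp
    then obtain T where T: "tournament_on V T" "\<forall>v\<in>V. score T v = s v"
      using Landau_existence[OF fin ge] by blast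
    define G :: "(nat, nat \<times> nat) pre_digraph"
      where "G = \<lparr>verts = V, arcs = {(u, v). T u v}, tail = fst, head = snd\<rparr>"
    have G: "tournament G" "\<And>v. out_degree G v = score T v" "verts G = V"
      using tournament_of_tournament_on[OF T(1) fin] by (simp_all add: G_def)
    have "image_mset (out_degree G) (mset_set (verts G)) = image_mset s (mset_set V)"
      unfolding G(2,3) using T(2) fin by (intro image_mset_cong) auto
    then have "score_sequence G = ?xs"
      using score_sequence_eq_iff[OF sorted_blocks[OF mono]] ms by metis
    then show ?L using G(1) unfolding correct_score_sequence_def by blast
  }
qed

section \<open>Membership in the net\<close>

text \<open>From left to right, a nonempty cell below level \<open>n\<close> already yields the
  inequality, and the second part of the algorithm yields the equality. Conversely, the inequalities
  keep every \<open>(p i, q i)\<close> inside the table, so the cells along this path are filled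
  level by level.\<close>

lemma in_net_iff:
  assumes "n \<ge> 2" and mono: "strict_mono_on {1..n} \<alpha>"
    and pos: "\<forall>i\<in>{1..n}. x i > 0"
    and p: "\<forall>i. p i = (\<Sum>j=1..i. x j)"
    and q: "\<forall>i. q i = (\<Sum>j=1..i. \<alpha> j * x j)"
  shows "(\<forall>i\<in>{1..n}. (p (i - 1), q (i - 1), x i) \<in> net n \<alpha> i (p i) (q i)) \<longleftrightarrow>
    (\<forall>i\<in>{1..n}. p i * (p i - 1) \<le> 2 * q i) \<and> p n * (p n - 1) = 2 * q n"
    (is "?L \<longleftrightarrow> ?R")
proof
  let ?\<alpha> = "\<alpha>(0 := 0)"
  have step: "p (Suc i) = p i + x (Suc i)" "q (Suc i) = q i + x (Suc i) * \<alpha> (Suc i)" for i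
    using p q by simp_all
  \<comment> \<open>Monotonicity of \<open>\<alpha>\<close> is given only from index 1 on; resetting
    the value at 0 to 0 extends it to the initial level.\<close>
  have \<alpha>_mono: "?\<alpha> i \<le> ?\<alpha> (Suc i)" if "i < n" for i
    using that strict_mono_onD[OF mono, of i "Suc i"] by (cases i) auto
  obtain m where n: "n = Suc m" "m \<ge> 1" using assms(1) by (cases n) auto
  {
    assume L: ?L
    have bnd: "p i * (p i - 1) \<le> 2 * q i" if "i \<in> {1..m}" for i
    proof -
      have "(p (i - 1), q (i - 1), x i) \<in> net n \<alpha> i (p i) (q i)" using L that n by auto
      then have ne: "first_part ?\<alpha> i (p i) (q i) \<noteq> {}" using that n by (auto simp: net_def)
      then have "p i * (p i - 1) \<le> 2 * q i \<and> q i \<le> p i * ?\<alpha> i"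
        using \<alpha>_mono that n by (intro first_part_bound[where \<alpha> = ?\<alpha> and k = i]) auto
      then show ?thesis ..
    qed
    have "(p m, q m, x n) \<in> net n \<alpha> n (p n) (q n)" using bspec[OF L, of n] n by simp
    then have "real (x n) = bound_B (p m) (q m) (\<alpha> n)"
      by (simp add: net_def second_part_def n)
    then have "p n * (p n - 1) = 2 * q n"
      using bound_B_iff(2)[of "p m" "q m" "x n" "\<alpha> n"] bnd[of m] pos n step[of m]
      by (simp add: Suc_le_eq)
    then show ?R using bnd n by (metis atLeastAtMost_iff le_Suc_eq order_refl)
  }
  {
    assume R: ?R
    have bnd: "p i * (p i - 1) \<le> 2 * q i" if "i \<le> n" for i
      using R that p by (cases "i = 0") auto
    have qle: "q i \<le> p i * ?\<alpha> i" if "i \<le> n" for i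
      using that
    proof (induction i)
      case 0
      then show ?case using q by simp
    next
      case (Suc i)
      then have "q i \<le> p i * ?\<alpha> i" by simp
      also have "\<dots> \<le> p i * ?\<alpha> (Suc i)" using \<alpha>_mono Suc.prems by (intro mult_le_mono2) simp
      finally show ?case unfolding step by (simp add: algebra_simps)
    qed
    have cell: "(p i, q i) \<in> cells ?\<alpha> i" if "i \<le> n" for i
      using cells_bound[of "p i" "q i" ?\<alpha> i] bnd qle that by blast
    \<comment> \<open>Nonemptiness is what the next level reads. The triple is claimed only for
      \<open>i \<noteq> 0\<close>: level 0 holds just \<open>(0, 0, 0)\<close>, while
      \<open>x 0\<close> is arbitrary.\<close>
    have ne: "first_part ?\<alpha> i (p i) (q i) \<noteq> {} \<and>
      (i \<noteq> 0 \<longrightarrow> (p (i - 1), q (i - 1), x i) \<in> first_part ?\<alpha> i (p i) (q i))" if "i \<le> m" for i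
      using that
    proof (induction i)
      case 0
      then show ?case using p q by simp
    next
      case (Suc i)
      then have ne: "first_part ?\<alpha> i (p i) (q i) \<noteq> {}" using Suc_leD by blast
      \<comment> \<open>The range that the algorithm imposes on \<open>x\<close> is automatic, since
        \<open>x (Suc i)\<close> is at most \<open>p (Suc i)\<close>, which lies in the table
        range.\<close>
      have "p (Suc i) \<le> 2 * ?\<alpha> (Suc i) + 1"
        using cell[of "Suc i"] Suc.prems n by (simp add: cells_def)
      then have "x (Suc i) \<le> 2 * \<alpha> (Suc i) + 1" unfolding step by simp
      moreover have x: "1 \<le> x (Suc i)" using pos Suc.prems n by (simp add: Suc_le_eq)
      moreover have "real (x (Suc i)) \<le> bound_B (p i) (q i) (\<alpha> (Suc i))"
        using bound_B_iff(1)[of "p i" "q i" "x (Suc i)" "\<alpha> (Suc i)"] bnd[of i] bnd[of "Suc i"] x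
          Suc.prems n step[of i] by simp
      ultimately have "(p i, q i, x (Suc i)) \<in> first_part ?\<alpha> (Suc i) (p (Suc i)) (q (Suc i))"
        using ne Suc.prems cell[of i] n step[of i] by simp
      then show ?case unfolding diff_Suc_1 by blast
    qed
    have "real (x n) = bound_B (p m) (q m) (\<alpha> n)"
      using bound_B_iff(2)[of "p m" "q m" "x n" "\<alpha> n"] bnd[of m] R pos n step[of m]
      by (simp add: Suc_le_eq)
    moreover have "first_part ?\<alpha> m (p m) (q m) \<noteq> {}" using ne by blast
    ultimately have "(p m, q m, x n) \<in> second_part ?\<alpha> n (p n) (q n)"
      using cell[of m] pos n step[of m] by (simp add: second_part_def Suc_le_eq)
    then have last: "(p m, q m, x n) \<in> net n \<alpha> n (p n) (q n)" by (simp add: net_def)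
    show ?L
    proof
      fix i assume i: "i \<in> {1..n}"
      show "(p (i - 1), q (i - 1), x i) \<in> net n \<alpha> i (p i) (q i)"
      proof (cases "i = n")
        case True
        then show ?thesis using last n(1) by simp
      next
        case False
        then have "i \<noteq> 0" "i \<le> m" "i < n" using i n(1) by auto
        then show ?thesis using ne[of i] unfolding net_def by presburger
      qed
    qed
  }
qed

theorem theorem3p4:
  fixes n :: nat and \<alpha> x p q :: "nat \<Rightarrow> nat"
  assumes "n \<ge> 2"
    and "strict_mono_on {1..n} \<alpha>"
    and "\<forall>i\<in>{1..n}. x i > 0"
    and "\<forall>i. p i = (\<Sum>j=1..i. x j)"
    and "\<forall>i. q i = (\<Sum>j=1..i. \<alpha> j * x j)"
  shows "correct_score_sequence n \<alpha> x \<longleftrightarrow>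
    (\<forall>i\<in>{1..n}. (p (i - 1), q (i - 1), x i) \<in> net n \<alpha> i (p i) (q i))"
  using correct_score_sequence_iff[OF _ assms(2,4,5)] in_net_iff[OF assms] assms(1) by simp

end
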